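(* Let $S_n$ be the symmetric group on $n$ symbols. The difference graph $D(S_n)$ is connected if and only if $n\geq 8$.
   Context: For a group $G$, the power graph $\mathsf{Pow}(G)$ has vertex set $G$, with distinct $a,b$ adjacent iff $a\in\langle b\rangle$ or $b\in\langle a\rangle$. The enhanced power graph $\mathsf{EPow}(G)$ has vertex set $G$, with distinct $a,b$ adjacent iff $\langle a,b\rangle$ is cyclic. The difference graph $D(G)$ is the graph $\mathsf{EPow}(G)-\mathsf{Pow}(G)$ with all isolated vertices removed; thus $x\sim y$ in $D(G)$ iff $\langle x,y\rangle$ is cyclic, $x\notin\langle y\rangle$ and $y\notin\langle x\rangle$. *)

theory Defs
  imports
    "Graph_Theory.Digraph_Component"
    "HOL-Algebra.Elementary_Groups"
    "HOL-Algebra.Sym_Groups"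
begin

text \<open>
  A simple graph is a symmetric loop-free \<^typ>\<open>'a pair_pre_digraph\<close>: an edge is
  represented by its two opposite arcs.
\<close>

definition power_graph :: "('a, 'b) monoid_scheme \<Rightarrow> 'a pair_pre_digraph" where
  "power_graph G = \<lparr> pverts = carrier G,
     parcs = {(a, b). a \<in> carrier G \<and> b \<in> carrier G \<and> a \<noteq> b \<and>
                (a \<in> generate G {b} \<or> b \<in> generate G {a})} \<rparr>"

definition enhanced_power_graph :: "('a, 'b) monoid_scheme \<Rightarrow> 'a pair_pre_digraph" where
  "enhanced_power_graph G = \<lparr> pverts = carrier G,
     parcs = {(a, b). a \<in> carrier G \<and> b \<in> carrier G \<and> a \<noteq> b \<and>
                cyclic_group (subgroup_generated G {a, b})} \<rparr>"

definition graph_minus :: "'a pair_pre_digraph \<Rightarrow> 'a pair_pre_digraph \<Rightarrow> 'a pair_pre_digraph" where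
  "graph_minus H K = \<lparr> pverts = pverts H, parcs = parcs H - parcs K \<rparr>"

definition isolated_verts :: "'a pair_pre_digraph \<Rightarrow> 'a set" where
  "isolated_verts H = {v \<in> pverts H. \<forall>w. (v, w) \<notin> parcs H \<and> (w, v) \<notin> parcs H}"

definition remove_isolated :: "'a pair_pre_digraph \<Rightarrow> 'a pair_pre_digraph" where
  "remove_isolated H = \<lparr> pverts = pverts H - isolated_verts H, parcs = parcs H \<rparr>"

definition difference_graph :: "('a, 'b) monoid_scheme \<Rightarrow> 'a pair_pre_digraph" where
  "difference_graph G = remove_isolated (graph_minus (enhanced_power_graph G) (power_graph G))"

text \<open>
  Connectedness is \<^const>\<open>Digraph_Component.connected\<close>, which is false for the graph
  with no vertices. This matters for symmetric groups on at most four symbols: all their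
  elements have prime power order, so their difference graph has no vertices.
\<close>

lemma (in group) difference_graph_adj:
  "(x, y) \<in> parcs (difference_graph G) \<longleftrightarrow>
     x \<in> carrier G \<and> y \<in> carrier G \<and> cyclic_group (subgroup_generated G {x, y}) \<and>
     x \<notin> generate G {y} \<and> y \<notin> generate G {x}"
  by (auto simp: difference_graph_def remove_isolated_def graph_minus_def
      enhanced_power_graph_def power_graph_def intro: generate.incl)

lemma (in group) difference_graph_verts:
  "v \<in> pverts (difference_graph G) \<longleftrightarrow> (\<exists>w. (v, w) \<in> parcs (difference_graph G))"
  by (auto simp: difference_graph_def remove_isolated_def graph_minus_def isolated_verts_def
      enhanced_power_graph_def power_graph_def insert_commute)

lemma (in group) pair_graph_difference_graph:
  assumes "finite (carrier G)"
  shows "pair_graph (difference_graph G)"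
proof
  have sub: "parcs (difference_graph G) \<subseteq> carrier G \<times> carrier G"
    by (auto simp: difference_graph_adj)
  then show "finite (parcs (difference_graph G))"
    using assms by (meson finite_SigmaI finite_subset)
  have "pverts (difference_graph G) \<subseteq> carrier G"
    using sub by (auto simp: difference_graph_verts)
  then show "finite (pverts (difference_graph G))"
    using assms finite_subset by blast
  have sym: "(y, x) \<in> parcs (difference_graph G)" if "(x, y) \<in> parcs (difference_graph G)" for x y
    using that by (auto simp: difference_graph_adj insert_commute)
  show "symmetric (with_proj (difference_graph G))"
    unfolding symmetric_def by (auto intro!: symI sym)
  fix e assume e: "e \<in> parcs (difference_graph G)"
  obtain x y where [simp]: "e = (x, y)" by (cases e)
  show "fst e \<in> pverts (difference_graph G)" "snd e \<in> pverts (difference_graph G)"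
    using e sym by (auto simp: difference_graph_verts)
  show "fst e \<noteq> snd e"
    using e by (auto simp: difference_graph_adj intro: generate.incl)
qed

end

theory Submission
  imports Defs "HOL-Number_Theory.Cong" "HOL-Algebra.Multiplicative_Group"
begin

text \<open>
  In a finite group, \<open>x\<close> and \<open>y\<close> are adjacent iff they lie in a common cyclic subgroup and
  neither order divides the other; consequently every vertex is joined by a path to an element of prime order
  that commutes with an element of a different prime order, and any two such commuting elements are adjacent.

  For \<open>n \<ge> 8\<close> every such element reaches a transposition. An odd prime order element with two
  fixed points is adjacent to one. An involution with three fixed points commutes with a 3-cycle, and one
  with three 2-cycles with the element of order 3 that permutes them cyclically. An element of odd
  prime order with two cycles commutes with an involution swapping them. Otherwise the element is a
  single cycle with at most one fixed point, whose centralizer it generates. Two transpositions have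
  a common neighbour, a 3-cycle disjoint from both.

  For \<open>n \<le> 4\<close> all orders are prime powers. For \<open>n = 5\<close> the transposition \<open>(1 2)\<close> and the 3-cycles
  on \<open>{3, 4, 5}\<close> form a component, and for \<open>n = 6, 7\<close> the elements of order 2 or 3 moving exactly
  six points are closed under adjacency. In all cases the key estimate is that if \<open>x\<close> has prime order
  \<open>p\<close>, moves \<open>s\<close> and commutes with \<open>y\<close> of order prime to \<open>p\<close>, then an invariant set containing \<open>s\<close>
  has at least \<open>p\<close> times the \<open>y\<close>-period of \<open>s\<close> many points.
\<close>

subsection \<open>Adjacency in terms of element orders\<close>

text \<open>Failure of divisibility shows at a single prime, whose multiplicity in \<open>b\<close>
  exceeds that in \<open>a\<close>; the exact power of it in \<open>b\<close> is the
  witness.\<close>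

lemma prime_power_dvd_witness:
  fixes a b :: nat
  assumes "\<not> b dvd a" "b > 0" "a > 0"
  obtains p k where "prime p" "p ^ k dvd b" "\<not> p ^ k dvd a"
proof -
  obtain p where p: "prime p" "multiplicity p a < multiplicity p b"
    using assms multiplicity_le_imp_dvd[of b a] by (metis neq0_conv not_le)
  have "\<not> p ^ multiplicity p b dvd a"
    using p assms by (subst power_dvd_iff_le_multiplicity) auto
  then show ?thesis
    using that[OF p(1) multiplicity_dvd] by blast
qed

context group
begin

text \<open>By Bezout, the powers of \<open>c\<close> with exponents \<open>i\<close> and
  \<open>j\<close> together generate the same subgroup as the single power with exponent
  \<open>gcd i j\<close>.\<close>

lemma cyclic_subgroup_generated_pair:
  assumes fin: "finite (carrier G)" and c: "c \<in> carrier G"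
    and x: "x \<in> generate G {c}" and y: "y \<in> generate G {c}"
  shows "cyclic_group (subgroup_generated G {x, y})"
proof -
  obtain i j :: nat where i: "x = c [^] i" and j: "y = c [^] j"
    using x y generate_pow_on_finite_carrier[OF fin c] by auto
  define d where "d = gcd i j"
  obtain u v where uv: "u * int i + v * int j = int d"
    using bezout_int[of "int i" "int j"] by (auto simp: d_def)
  have carr: "x \<in> carrier G" "y \<in> carrier G" "c [^] d \<in> carrier G"
    using c i j by auto
  have "c [^] d = c [^] (int i * u) \<otimes> c [^] (int j * v)"
    using uv c by (metis int_pow_int int_pow_mult mult.commute)
  also have "\<dots> = x [^] u \<otimes> y [^] v"
    using c i j by (metis int_pow_int int_pow_pow)
  finally have *: "c [^] d = x [^] u \<otimes> y [^] v" .
  have sub: "subgroup (generate G {x, y}) G"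
    using carr generate_is_subgroup by simp
  have "x [^] u \<in> generate G {x, y}" "y [^] v \<in> generate G {x, y}"
    using subgroup_int_pow_closed[OF sub] by (simp_all add: generate.incl)
  then have 1: "c [^] d \<in> generate G {x, y}"
    using * sub subgroup.m_closed by metis
  have pw: "c [^] (d * k) \<in> generate G {c [^] d}" for k :: nat
    using generate_pow_on_finite_carrier[OF fin carr(3)] c by (auto simp: nat_pow_pow)
  obtain k l where "i = d * k" "j = d * l"
    unfolding d_def by (meson dvd_def gcd_dvd1 gcd_dvd2)
  then have 2: "x \<in> generate G {c [^] d}" "y \<in> generate G {c [^] d}"
    using pw i j by auto
  have "generate G {x, y} = generate G {c [^] d}"
    using 1 2 carr generate_subgroup_incl[OF _ generate_is_subgroup] sub
    by (intro equalityI) auto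
  then have "subgroup_generated G {x, y} = subgroup_generated G {c [^] d}"
    using carr by (simp add: subgroup_generated_def)
  then show ?thesis
    using cyclic_group_generated by simp
qed

lemma cyclic_subgroup_generated_pairD:
  assumes x: "x \<in> carrier G" and y: "y \<in> carrier G" and cyc: "cyclic_group (subgroup_generated G {x, y})"
  shows "\<exists>c\<in>carrier G. x \<in> generate G {c} \<and> y \<in> generate G {c}"
proof -
  interpret H: group "subgroup_generated G {x, y}" by simp
  obtain c where c: "c \<in> carrier (subgroup_generated G {x, y})"
    and r: "carrier (subgroup_generated G {x, y}) = range (\<lambda>n::int. c [^]\<^bsub>subgroup_generated G {x, y}\<^esub> n)"
    using cyc H.cyclic_group by auto
  have cG: "c \<in> carrier G"
    using c carrier_subgroup_generated_subset by blast
  have "range (\<lambda>n::int. c [^] n) = generate G {c}"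
    using generate_pow[OF cG] by auto
  moreover have "carrier (subgroup_generated G {x, y}) = range (\<lambda>n::int. c [^] n)"
    using r c by (simp add: int_pow_subgroup_generated)
  moreover have "x \<in> carrier (subgroup_generated G {x, y})" "y \<in> carrier (subgroup_generated G {x, y})"
    using x y by (auto simp: carrier_subgroup_generated intro: generate.incl)
  ultimately show ?thesis using cG by blast
qed

text \<open>A finite cyclic group has exactly one subgroup of each possible order, so containment of
  its subgroups is divisibility of orders.\<close>

lemma mem_generate_iff_ord_dvd:
  assumes fin: "finite (carrier G)" and c: "c \<in> carrier G"
    and x: "x \<in> generate G {c}" and y: "y \<in> generate G {c}"
  shows "x \<in> generate G {y} \<longleftrightarrow> ord x dvd ord y"
proof -
  obtain i j :: nat where i: "x = c [^] i" and j: "y = c [^] j"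
    using x y generate_pow_on_finite_carrier[OF fin c] by auto
  have carr: "x \<in> carrier G" "y \<in> carrier G" using i j c by auto
  note gy = generate_pow_on_finite_carrier[OF fin carr(2)]
  show ?thesis
  proof
    assume "x \<in> generate G {y}"
    then obtain k :: nat where "x = y [^] k" using gy by auto
    then have "x [^] ord y = \<one>"
      using carr by (metis nat_pow_pow mult.commute pow_ord_eq_1 nat_pow_one)
    then show "ord x dvd ord y" using pow_eq_id carr by blast
  next
    assume d: "ord x dvd ord y"
    define N where "N = ord c"
    define g where "g = gcd j N"
    have N: "N > 0" using ord_ge_1[OF fin c] by (simp add: N_def)
    then have gN: "g * (N div g) = N" "g > 0" by (auto simp: g_def)
    \<comment> \<open>The order of \<open>y\<close> divides \<open>N div g\<close>, hence so does
      that of \<open>x\<close>. Comparing exponents of \<open>c\<close> modulo \<open>N\<close> then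
      gives that \<open>g\<close> divides \<open>i\<close>.\<close>
    have "y [^] (N div g) = c [^] (N * (j div g))"
      using c j by (simp add: nat_pow_pow g_def) (metis dvd_div_mult dvd_div_mult2_eq div_mult_swap gcd_dvd1 gcd_dvd2 mult.commute)
    also have "\<dots> = \<one>" using c by (metis N_def dvd_triv_left pow_eq_id)
    finally have "ord y dvd N div g" using carr pow_eq_id by blast
    then have "x [^] (N div g) = \<one>" using d carr pow_eq_id dvd_trans by blast
    then have "c [^] (i * (N div g)) = \<one>" using i c by (simp add: nat_pow_pow)
    then have "g * (N div g) dvd i * (N div g)" using gN c pow_eq_id N_def by metis
    moreover have "N div g > 0" using gN N by (metis mult_0_right neq0_conv)
    ultimately have "g dvd i" by simp
    then obtain a where a: "i = g * a" by blast
    obtain u v where uv: "u * int j + v * int N = int g"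
      using bezout_int[of "int j" "int N"] by (auto simp: g_def)
    \<comment> \<open>Bezout for \<open>g\<close>, multiplied by \<open>a\<close>, makes
      \<open>i\<close> a multiple of \<open>j\<close> modulo \<open>N\<close>.\<close>
    have "int i = int j * (u * int a) + int N * (v * int a)"
      unfolding a of_nat_mult uv[symmetric] by (simp add: algebra_simps)
    then have "c [^] int i = c [^] (int j * (u * int a)) \<otimes> c [^] (int N * (v * int a))"
      using c int_pow_mult by metis
    also have "c [^] (int N * (v * int a)) = \<one>"
      using c int_pow_eq_id N_def dvd_triv_left by metis
    also have "c [^] (int j * (u * int a)) = y [^] (u * int a)"
      using c j by (metis int_pow_int int_pow_pow)
    finally have "x = y [^] (u * int a)"
      using i c carr by (simp add: int_pow_int)
    then show "x \<in> generate G {y}" using generate_pow[OF carr(2)] by blast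
  qed
qed

lemma difference_graph_adj_iff_ord:
  assumes fin: "finite (carrier G)"
  shows "(x, y) \<in> parcs (difference_graph G) \<longleftrightarrow>
    (\<exists>c\<in>carrier G. x \<in> generate G {c} \<and> y \<in> generate G {c} \<and> \<not> ord x dvd ord y \<and> \<not> ord y dvd ord x)"
    (is "?L \<longleftrightarrow> ?R")
proof
  assume L: ?L
  then have "x \<in> carrier G" "y \<in> carrier G" "cyclic_group (subgroup_generated G {x, y})"
    by (auto simp: difference_graph_adj)
  from cyclic_subgroup_generated_pairD[OF this] L show ?R
    using mem_generate_iff_ord_dvd[OF fin] unfolding difference_graph_adj by metis
next
  assume ?R
  then obtain c where c: "c\<in>carrier G" "x \<in> generate G {c}" "y \<in> generate G {c}"
    "\<not> ord x dvd ord y" "\<not> ord y dvd ord x" by blast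
  then show ?L unfolding difference_graph_adj
    using cyclic_subgroup_generated_pair[OF fin c(1-3)] mem_generate_iff_ord_dvd[OF fin c(1)]
      generate_in_carrier[of "{c}"] c by auto
qed

lemma generate_singleton_commute:
  assumes fin: "finite (carrier G)" and c: "c \<in> carrier G"
    and x: "x \<in> generate G {c}" and y: "y \<in> generate G {c}"
  shows "x \<otimes> y = y \<otimes> x"
  using x y generate_pow_on_finite_carrier[OF fin c] c by (auto simp: nat_pow_mult add.commute)

text \<open>Both elements are powers of their product: an exponent divisible by one order and
  congruent to 1 modulo the other kills one factor and keeps the other.\<close>

lemma difference_graph_adj_prime_ord:
  assumes fin: "finite (carrier G)" and x: "x \<in> carrier G" and y: "y \<in> carrier G"
    and comm: "x \<otimes> y = y \<otimes> x" and p: "prime (ord x)" "prime (ord y)" "ord x \<noteq> ord y"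
  shows "(x, y) \<in> parcs (difference_graph G)"
proof -
  have *: "\<exists>k::nat. (u \<otimes> v) [^] k = u"
    if "u \<in> carrier G" "v \<in> carrier G" "u \<otimes> v = v \<otimes> u" "prime (ord u)" "prime (ord v)" "ord u \<noteq> ord v" for u v
  proof -
    have "coprime (ord v) (ord u)" using that by (simp add: primes_coprime)
    then obtain k where k: "[ord v * k = 1] (mod ord u)"
      using cong_solve_coprime_nat by (metis One_nat_def)
    have "(u \<otimes> v) [^] (ord v * k) = u [^] (ord v * k) \<otimes> v [^] (ord v * k)"
      using that pow_mult_distrib by blast
    also have "v [^] (ord v * k) = \<one>" using that by (simp add: pow_eq_id)
    also have "u [^] (ord v * k) = u [^] (1::nat)"
    proof -
      have "int (ord u) dvd int 1 - int (ord v * k)"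
        using k by (metis cong_iff_dvd_diff cong_int_iff cong_sym)
      then show ?thesis using that(1) int_pow_eq by (metis int_pow_int)
    qed
    finally have "(u \<otimes> v) [^] (ord v * k) = u" using that by simp
    then show ?thesis by blast
  qed
  have xy: "x \<otimes> y \<in> carrier G" using x y by simp
  have "x \<in> generate G {x \<otimes> y}" "y \<in> generate G {x \<otimes> y}"
    using *[OF x y comm p] *[OF y x comm[symmetric] p(2,1) p(3)[symmetric]] comm
      generate_pow_on_finite_carrier[OF fin xy] by auto metis+
  then show ?thesis
    unfolding difference_graph_adj_iff_ord[OF fin] using xy p by (metis primes_dvd_imp_eq)
qed

lemma difference_graph_adj_prime_ordD:
  assumes fin: "finite (carrier G)" and xy: "(x, y) \<in> parcs (difference_graph G)" and p: "prime (ord x)"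
  shows "x \<in> carrier G" "y \<in> carrier G" "x \<otimes> y = y \<otimes> x" "\<not> ord x dvd ord y" "y \<noteq> \<one>"
proof -
  obtain c where c: "c \<in> carrier G" "x \<in> generate G {c}" "y \<in> generate G {c}"
    and d: "\<not> ord x dvd ord y" "\<not> ord y dvd ord x"
    using xy unfolding difference_graph_adj_iff_ord[OF fin] by blast
  show "x \<in> carrier G" "y \<in> carrier G"
    using c generate_in_carrier[of "{c}"] by auto
  show "x \<otimes> y = y \<otimes> x" using generate_singleton_commute[OF fin c] .
  show "\<not> ord x dvd ord y" by fact
  show "y \<noteq> \<one>" using d by auto
qed

text \<open>Everything happens among the powers of a common \<open>c\<close>. The non-divisibilities
  yield two distinct primes \<open>q\<close> and \<open>p\<close>, one from each order; suitable
  powers of \<open>y\<close> and \<open>x\<close> form the path, and \<open>w\<close> records that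
  \<open>z\<close> commutes with an element of another prime order.\<close>

lemma difference_graph_reaches_prime_ord:
  assumes fin: "finite (carrier G)" and xy: "(x, y) \<in> parcs (difference_graph G)"
  obtains y' z w where "(x, y') \<in> parcs (difference_graph G)" "(y', z) \<in> parcs (difference_graph G)"
    "z \<in> carrier G" "w \<in> carrier G" "z \<otimes> w = w \<otimes> z"
    "prime (ord z)" "prime (ord w)" "ord z \<noteq> ord w"
proof -
  obtain c where c: "c \<in> carrier G" "x \<in> generate G {c}" "y \<in> generate G {c}"
    and d: "\<not> ord x dvd ord y" "\<not> ord y dvd ord x"
    using xy unfolding difference_graph_adj_iff_ord[OF fin] by blast
  have carr: "x \<in> carrier G" "y \<in> carrier G"
    using c generate_in_carrier[of "{c}"] by auto
  have pos: "ord x > 0" "ord y > 0" using ord_ge_1[OF fin] carr by (metis less_eq_Suc_le One_nat_def)+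
  obtain q i where q: "prime q" "q ^ i dvd ord x" "\<not> q ^ i dvd ord y"
    using prime_power_dvd_witness[OF d(1) pos] .
  obtain p j where p: "prime p" "p ^ j dvd ord y" "\<not> p ^ j dvd ord x"
    using prime_power_dvd_witness[OF d(2) pos(2,1)] .
  have ij: "i \<noteq> 0" "j \<noteq> 0" using p q by (metis one_dvd power_0)+
  \<comment> \<open>Powers of one prime are comparable, so equality would make one of the two powers
    divide both orders.\<close>
  have pq: "p \<noteq> q"
    using p q by (metis dvd_trans le_imp_power_dvd linear)
  have pdvd: "p dvd ord y" and qdvd: "q dvd ord x"
    using ij p q by (metis dvd_power dvd_trans neq0_conv)+
  have ord_quot: "ord (u [^] (ord u div m)) = m" if "u \<in> carrier G" "m dvd ord u" "ord u > 0" for u m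
    using that by (subst ord_pow) (auto elim!: dvdE)
  have pow_gen: "u [^] m \<in> generate G {c}" if "u \<in> generate G {c}" for u and m :: nat
    using that c generate_pow_on_finite_carrier[OF fin c(1)] by (auto simp: nat_pow_pow)
  \<comment> \<open>The order is \<open>p ^ j\<close> and not \<open>p\<close>, since
    \<open>p\<close> itself may divide the order of \<open>x\<close>, and then an element of order
    \<open>p\<close> would not be adjacent to \<open>x\<close>.\<close>
  define y' where "y' = y [^] (ord y div p ^ j)"
  define z where "z = x [^] (ord x div q)"
  define w where "w = y [^] (ord y div p)"
  have ords: "ord y' = p ^ j" "ord z = q" "ord w = p"
    using ord_quot carr pos p q pdvd qdvd by (simp_all add: y'_def z_def w_def)
  have gens: "y' \<in> generate G {c}" "z \<in> generate G {c}" "w \<in> generate G {c}"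
    using pow_gen c by (simp_all add: y'_def z_def w_def)
  have qp: "\<not> q dvd p ^ j" using pq p q by (metis prime_dvd_power primes_dvd_imp_eq)
  have pq': "\<not> p ^ j dvd q" using pq p q ij by (metis dvd_power dvd_trans neq0_conv primes_dvd_imp_eq)
  show ?thesis
  proof (rule that[of y' z w])
    show "(x, y') \<in> parcs (difference_graph G)" "(y', z) \<in> parcs (difference_graph G)"
      unfolding difference_graph_adj_iff_ord[OF fin] using c gens ords qp pq' p(3) qdvd by (metis dvd_trans)+
    show "z \<in> carrier G" "w \<in> carrier G"
      using gens c generate_in_carrier[of "{c}"] by auto
    show "z \<otimes> w = w \<otimes> z" using generate_singleton_commute[OF fin c(1)] gens by blast
  qed (use ords p q pq in auto)
qed

end

subsection \<open>Commuting permutations\<close>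

lemma sym_group_pow: "x [^]\<^bsub>sym_group n\<^esub> (k::nat) = x ^^ k"
  by (induction k) (simp_all add: nat_pow_def sym_group_def funpow_swap1 fun_eq_iff)

lemma sym_group_finite: "finite (carrier (sym_group n))"
  by (simp add: sym_group_def finite_permutations)

lemma sym_group_funpow_eq_id:
  assumes "x \<in> carrier (sym_group n)"
  shows "x ^^ k = id \<longleftrightarrow> group.ord (sym_group n) x dvd k"
  using group.pow_eq_id[OF sym_group_is_group assms] by (simp add: sym_group_pow sym_group_one)

lemma sym_group_ord_eq_prime:
  assumes "x \<in> carrier (sym_group n)" "x ^^ p = id" "x \<noteq> id" "prime p"
  shows "group.ord (sym_group n) x = p"
proof -
  have "group.ord (sym_group n) x dvd p"
    using assms sym_group_funpow_eq_id by blast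
  moreover have "group.ord (sym_group n) x \<noteq> 1"
    using assms sym_group_funpow_eq_id[OF assms(1), of 1] by auto
  ultimately show ?thesis using assms(4) prime_nat_iff by blast
qed

section \<open>Periods of points in invariant sets\<close>

lemma funpow_in_invariant:
  assumes "f ` S \<subseteq> S" "s \<in> S"
  shows "(f ^^ k) s \<in> S"
  using assms by (induction k) auto

lemma funpow_commute_comp:
  assumes "x \<circ> y = y \<circ> x"
  shows "(x \<circ> y) ^^ k = x ^^ k \<circ> y ^^ k"
proof (induction k)
  case (Suc k)
  have "y \<circ> x ^^ k = x ^^ k \<circ> y" for k
    using assms by (induction k) (simp_all add: fun_eq_iff, metis)
  then show ?case using Suc by (simp add: fun_eq_iff)
qed simp

lemma least_power_le_card:
  assumes "permutation f" "finite S" "f ` S \<subseteq> S" "s \<in> S"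
  shows "least_power f s \<le> card S"
proof -
  have "set (support f s) \<subseteq> S"
    using funpow_in_invariant[OF assms(3,4)] by auto
  then have "card (set (support f s)) \<le> card S"
    using assms card_mono by blast
  then show ?thesis
    using distinct_card[OF cycle_of_permutation[OF assms(1)]] by simp
qed

text \<open>The period of \<open>s\<close> under \<open>x \<circ> y\<close> is a multiple of both \<open>p\<close> and the period under \<open>y\<close>.\<close>

lemma mult_least_power_le_card:
  assumes x: "permutation x" and y: "permutation y" and comm: "x \<circ> y = y \<circ> x"
    and p: "prime p" "x ^^ p = id" and m: "y ^^ m = id" "\<not> p dvd m"
    and S: "finite S" "x ` S \<subseteq> S" "y ` S \<subseteq> S" and s: "s \<in> S" "x s \<noteq> s"
  shows "p * least_power y s \<le> card S"
proof -
  define c where "c = x \<circ> y"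
  define D where "D = least_power c s"
  have c: "permutation c" using x y by (simp add: c_def permutation_compose)
  have cp: "c ^^ k = x ^^ k \<circ> y ^^ k" for k
    unfolding c_def by (rule funpow_commute_comp[OF comm])
  have xs: "least_power x s = p"
  proof -
    have "least_power x s dvd p" using p least_power_dvd[OF x] by simp
    moreover have "least_power x s \<noteq> 1" using s least_power_gt_one[OF x, of s] by auto
    ultimately show ?thesis using p prime_nat_iff by blast
  qed
  have idp: "x ^^ (p * k) = id" "y ^^ (m * k) = id" for k
    using p m by (metis funpow_mult id_funpow)+
  \<comment> \<open>The exponent \<open>m\<close> removes \<open>y\<close>, so the period of
    \<open>s\<close> under \<open>x\<close>, which is \<open>p\<close>, divides
    \<open>m * D\<close>; as \<open>p\<close> does not divide \<open>m\<close>, it divides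
    \<open>D\<close>. Afterwards the exponent \<open>D\<close> removes \<open>x\<close> in the same
    way.\<close>
  have "(c ^^ (m * D)) s = s"
    using least_power_dvd[OF c, of s "m * D"] by (simp add: D_def)
  then have "(x ^^ (m * D)) s = s" by (simp add: cp idp)
  then have "p dvd m * D" using least_power_dvd[OF x] xs by metis
  then have pD: "p dvd D" using p m by (simp add: prime_dvd_mult_iff)
  then obtain k where "D = p * k" by blast
  moreover have "(c ^^ D) s = s" using least_power_of_permutation[OF c] by (simp add: D_def)
  ultimately have "(y ^^ D) s = s" by (simp add: cp idp)
  then have dD: "least_power y s dvd D" using least_power_dvd[OF y] by blast
  have "least_power y s dvd m" using m least_power_dvd[OF y] by simp
  then have "coprime p (least_power y s)"
    using p m dvd_trans prime_imp_coprime by blast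
  then have "p * least_power y s dvd D" using pD dD by (simp add: divides_mult)
  moreover have "0 < D" using least_power_of_permutation[OF c] by (simp add: D_def)
  moreover have "D \<le> card S"
    unfolding D_def using least_power_le_card[OF c S(1) _ s(1)] S by (auto simp: c_def)
  ultimately show ?thesis using dvd_imp_le le_trans by blast
qed

text \<open>The points \<open>f (k, i)\<close> form \<open>r\<close> cycles of \<open>z\<close> of
  common length \<open>d\<close>. Applying \<open>z\<close> advances \<open>k\<close> and applying
  \<open>w\<close> advances \<open>i\<close>, so the two commute. Used with \<open>d = 1\<close> for
  a cycle on fixed points, with \<open>r = 2\<close> for swapping two cycles, and with
  \<open>d = 2\<close>, \<open>r = 3\<close> for rotating three 2-cycles.\<close>

lemma commuting_cyclic_shift:
  fixes z :: "'a \<Rightarrow> 'a" and s :: "nat \<Rightarrow> 'a"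
  defines "f \<equiv> \<lambda>(k, i). (z ^^ k) (s i)"
  assumes z: "z permutes X" and d: "0 < d" and r: "2 \<le> r"
    and sX: "\<And>i. i < r \<Longrightarrow> s i \<in> X" and fixd: "\<And>i. i < r \<Longrightarrow> (z ^^ d) (s i) = s i"
    and inj: "inj_on f ({..<d} \<times> {..<r})"
  obtains w where "w permutes X" "z \<circ> w = w \<circ> z" "w ^^ r = id" "{a. w a \<noteq> a} = f ` ({..<d} \<times> {..<r})"
proof -
  define I where "I = {..<d} \<times> {..<r}"
  define w where "w a = (if a \<in> f ` I then case inv_into I f a of (k, i) \<Rightarrow> f (k, Suc i mod r) else a)" for a
  have w1: "w (f (k, i)) = f (k, Suc i mod r)" if "k < d" "i < r" for k i
  proof -
    have "(k, i) \<in> I" using that by (simp add: I_def)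
    then show ?thesis using inj by (simp add: w_def I_def inv_into_f_f)
  qed
  have wpow: "(w ^^ m) (f (k, i)) = f (k, (i + m) mod r)" if "k < d" "i < r" for k i m
    by (induction m) (use that w1[of k] in \<open>simp_all add: mod_Suc_eq\<close>)
  have wout: "w a = a" if "a \<notin> f ` I" for a using that by (simp add: w_def)
  have woutpow: "(w ^^ m) a = a" if "a \<notin> f ` I" for a m
    by (induction m) (use that wout in simp_all)
  have wr: "w ^^ r = id"
  proof
    fix a
    show "(w ^^ r) a = id a"
      by (cases "a \<in> f ` I") (use wpow woutpow in \<open>auto simp: I_def\<close>)
  qed
  have fX: "f ` I \<subseteq> X"
    using sX permutes_in_image[OF permutes_funpow[OF z]] by (auto simp: f_def I_def)
  \<comment> \<open>The power \<open>w ^^ (r - 1)\<close> is a two-sided inverse, which gives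
    bijectivity.\<close>
  have "w \<circ> w ^^ (r - 1) = id" "w ^^ (r - 1) \<circ> w = id"
    using wr r funpow.simps(2)[of "r - 1" w] funpow_Suc_right[of "r - 1" w] by auto
  then have "bij w" using o_bij by blast
  then have wX: "w permutes X"
    using wout fX unfolding permutes_def bij_iff by blast
  \<comment> \<open>The wrap-around at \<open>Suc k = d\<close> is where \<open>fixd\<close>
    enters.\<close>
  have zf: "z (f (k, i)) = f (Suc k mod d, i)" if "k < d" "i < r" for k i
    using that fixd by (cases "Suc k = d") (auto simp: f_def)
  \<comment> \<open>Being finite and mapped into itself, the set of shifted points is mapped onto
    itself; hence \<open>z\<close> also preserves its complement, where \<open>w\<close> is the
    identity.\<close>
  have "z ` f ` I \<subseteq> f ` I"
    using zf d by (auto simp: I_def intro!: imageI)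
  moreover have "finite (f ` I)" by (simp add: I_def)
  ultimately have zfI: "z ` f ` I = f ` I"
    using permutes_inj[OF z] by (metis endo_inj_surj inj_on_subset subset_UNIV)
  have "z \<circ> w = w \<circ> z"
  proof
    fix a
    show "(z \<circ> w) a = (w \<circ> z) a"
    proof (cases "a \<in> f ` I")
      case True
      then obtain k i where a: "a = f (k, i)" "k < d" "i < r" by (auto simp: I_def)
      then show ?thesis using d zf w1 by simp
    next
      case False
      then have "z a \<notin> f ` I" using zfI permutes_inj[OF z] by (metis inj_image_mem_iff)
      then show ?thesis using False wout by simp
    qed
  qed
  moreover have "{a. w a \<noteq> a} = f ` I"
  proof
    show "f ` I \<subseteq> {a. w a \<noteq> a}"
    proof clarify
      fix k i assume ki: "(k, i) \<in> I" and "w (f (k, i)) = f (k, i)"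
      then have "f (k, Suc i mod r) = f (k, i)" using w1 by (simp add: I_def)
      moreover have "(k, Suc i mod r) \<in> I" using ki by (auto simp: I_def)
      ultimately have "Suc i mod r = i" using inj ki unfolding I_def inj_on_def by blast
      then show False using ki r by (cases "Suc i = r") (auto simp: I_def)
    qed
  qed (use wout in auto)
  ultimately show ?thesis using that wX wr by (simp add: I_def)
qed

subsection \<open>Disconnectedness for at most seven symbols\<close>

lemma sym_difference_graph: "sym (parcs (difference_graph (sym_group n)))"
  using group.difference_graph_adj[OF sym_group_is_group] by (intro symI) (auto simp: insert_commute)

text \<open>Connectedness is phrased with paths in the symmetric closure of the arcs; this removes
  the closure.\<close>

lemma symcl_difference_graph:
  "(parcs (difference_graph (sym_group n)))\<^sup>s = parcs (difference_graph (sym_group n))"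
  using sym_difference_graph[of n] by (auto simp: symcl_def sym_def)

lemma difference_graph_arc_verts:
  assumes "(x, y) \<in> parcs (difference_graph (sym_group n))"
  shows "x \<in> pverts (difference_graph (sym_group n))" "y \<in> pverts (difference_graph (sym_group n))"
  using assms sym_difference_graph[of n]
  by (auto simp: group.difference_graph_verts[OF sym_group_is_group] dest: symD)

text \<open>A set closed under adjacency is never left by a path. Disconnectedness thus follows from
  a closed set containing one vertex and missing another.\<close>

lemma connected_difference_graph_closed:
  assumes con: "Digraph_Component.connected (with_proj (difference_graph (sym_group n)))"
    and closed: "\<And>x y. x \<in> A \<Longrightarrow> (x, y) \<in> parcs (difference_graph (sym_group n)) \<Longrightarrow> y \<in> A"
    and u: "u \<in> A" "(u, u') \<in> parcs (difference_graph (sym_group n))"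
    and v: "(v, v') \<in> parcs (difference_graph (sym_group n))"
  shows "v \<in> A"
proof -
  let ?D = "difference_graph (sym_group n)"
  have "(u, v) \<in> rtrancl_on (pverts ?D) (parcs ?D)"
    using con difference_graph_arc_verts[OF u(2)] difference_graph_arc_verts[OF v]
    by (simp add: connected_conv symcl_difference_graph)
  then show ?thesis
    by (induction rule: rtrancl_on_induct) (use u closed in auto)
qed

lemma connected_difference_graphI:
  assumes h: "h \<in> pverts (difference_graph (sym_group n))"
    and reach: "\<And>v v'. (v, v') \<in> parcs (difference_graph (sym_group n)) \<Longrightarrow>
      (v, h) \<in> (parcs (difference_graph (sym_group n)))\<^sup>*"
  shows "Digraph_Component.connected (with_proj (difference_graph (sym_group n)))"
proof -
  let ?D = "difference_graph (sym_group n)"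
  \<comment> \<open>Ends of arcs are vertices, so the restriction of paths to the vertex set is
    automatic.\<close>
  have on: "(u, v) \<in> rtrancl_on (pverts ?D) (parcs ?D)" if "(u, v) \<in> (parcs ?D)\<^sup>*" "u \<in> pverts ?D" for u v
    using that by induction (auto intro: rtrancl_on_into_rtrancl_on difference_graph_arc_verts)
  have "(u, v) \<in> (parcs ?D)\<^sup>*" if "u \<in> pverts ?D" "v \<in> pverts ?D" for u v
  proof -
    have "(u, h) \<in> (parcs ?D)\<^sup>*" "(v, h) \<in> (parcs ?D)\<^sup>*"
      using that reach by (auto simp: group.difference_graph_verts[OF sym_group_is_group])
    then show ?thesis
      using sym_difference_graph[of n] sym_rtrancl symD rtrancl_trans by metis
  qed
  then show ?thesis
    using on h by (auto simp: connected_conv symcl_difference_graph)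
qed

section \<open>Neighbours of permutations of prime order\<close>

lemma sym_group_adj_prime_ordD:
  assumes xy: "(x, y) \<in> parcs (difference_graph (sym_group n))" and p: "prime (group.ord (sym_group n) x)"
  shows "x permutes {1..n}" "y permutes {1..n}" "x \<circ> y = y \<circ> x"
    "\<not> group.ord (sym_group n) x dvd group.ord (sym_group n) y" "y \<noteq> id"
  using group.difference_graph_adj_prime_ordD[OF sym_group_is_group sym_group_finite xy p]
  by (simp_all add: sym_group_carrier sym_group_mult sym_group_one)

lemma commute_image_moved:
  assumes "y permutes X" "x \<circ> y = y \<circ> x"
  shows "y ` {a. x a \<noteq> a} \<subseteq> {a. x a \<noteq> a}" "y ` {a. x a = a} \<subseteq> {a. x a = a}"
proof -
  have "x (y a) = y (x a)" for a using assms(2) by (metis comp_apply)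
  then show "y ` {a. x a \<noteq> a} \<subseteq> {a. x a \<noteq> a}" "y ` {a. x a = a} \<subseteq> {a. x a = a}"
    using permutes_inj[OF assms(1)] by (auto dest: injD)
qed

text \<open>These constraints on the cycle lengths of a neighbour \<open>y\<close> are what pin it
  down. For instance, if \<open>S\<close> has fewer than twice \<open>ord x\<close> points, then
  \<open>y\<close> fixes every point of \<open>S\<close> that \<open>x\<close> moves.\<close>

lemma adj_prime_ord_period:
  assumes xy: "(x, y) \<in> parcs (difference_graph (sym_group n))" and p: "prime (group.ord (sym_group n) x)"
    and S: "finite S" "x ` S \<subseteq> S" "y ` S \<subseteq> S" "s \<in> S"
  shows "x s \<noteq> s \<Longrightarrow> group.ord (sym_group n) x * least_power y s \<le> card S"
    "least_power y s \<le> card S" "least_power y s > 0"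
    "\<not> group.ord (sym_group n) x dvd least_power y s"
proof -
  note D = sym_group_adj_prime_ordD[OF xy p]
  have P: "permutation x" "permutation y" using D permutes_imp_permutation by blast+
  have yo: "y ^^ group.ord (sym_group n) y = id"
    using sym_group_funpow_eq_id D by (simp add: sym_group_carrier)
  have xo: "x ^^ group.ord (sym_group n) x = id"
    using sym_group_funpow_eq_id D by (simp add: sym_group_carrier)
  show "group.ord (sym_group n) x * least_power y s \<le> card S" if "x s \<noteq> s"
    using mult_least_power_le_card[OF P D(3) p xo yo D(4) S that] .
  show "least_power y s \<le> card S" using least_power_le_card[OF P(2)] S by blast
  show "least_power y s > 0" using least_power_of_permutation[OF P(2)] by blast
  have "least_power y s dvd group.ord (sym_group n) y" using yo least_power_dvd[OF P(2)] by simp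
  then show "\<not> group.ord (sym_group n) x dvd least_power y s" using D(4) dvd_trans by blast
qed

lemma least_power_eq_1: "permutation y \<Longrightarrow> least_power y s = 1 \<longleftrightarrow> y s = s"
  using least_power_dvd[of y s 1] by simp

text \<open>The points moved by \<open>y\<close> form a nonempty set \<open>T\<close> invariant
  under both permutations, and each has period \<open>q\<close>. The bound gives \<open>T\<close> at
  least \<open>m * q\<close> points, which is all of \<open>S\<close>. For five symbols
  \<open>S\<close> is the fixed set of \<open>x\<close> and \<open>m = 1\<close>; for six and seven
  it is the moved set and \<open>m\<close> is the order of \<open>x\<close>.\<close>

lemma ord_and_moved_of_neighbour:
  assumes xy: "(x, y) \<in> parcs (difference_graph (sym_group n))" and p: "prime (group.ord (sym_group n) x)"
    and S: "finite S" "S \<noteq> {}" "x ` S \<subseteq> S" "y ` S \<subseteq> S" "\<And>a. a \<notin> S \<Longrightarrow> y a = a"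
    and q: "prime q" "\<And>s. s \<in> S \<Longrightarrow> least_power y s dvd q" "m * q = card S"
    and bound: "\<And>T s. \<lbrakk>T \<subseteq> S; x ` T \<subseteq> T; y ` T \<subseteq> T; s \<in> T\<rbrakk> \<Longrightarrow> m * least_power y s \<le> card T"
  shows "group.ord (sym_group n) y = q \<and> {a. y a \<noteq> a} = S"
proof -
  note D = sym_group_adj_prime_ordD[OF xy p]
  have Py: "permutation y" using D permutes_imp_permutation by blast
  define T where "T = {a \<in> S. y a \<noteq> a}"
  have "x ` T \<subseteq> T" "y ` T \<subseteq> T"
    using commute_image_moved(1)[OF D(1), of y] commute_image_moved(1)[OF D(2), of y] D(3) S
    by (auto simp: T_def)
  moreover obtain s where s: "s \<in> T"
    using D(5) S(5) by (fastforce simp: T_def)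
  ultimately have "m * least_power y s \<le> card T"
    by (intro bound) (auto simp: T_def)
  moreover have "least_power y s = q"
    using q(1) q(2)[of s] s least_power_gt_one[OF Py, of s] by (auto simp: T_def prime_nat_iff)
  ultimately have "card S \<le> card T" using q by simp
  then have "T = S" using S by (intro card_seteq) (auto simp: T_def)
  then have mv: "{a. y a \<noteq> a} = S" using S(5) by (auto simp: T_def)
  have "(y ^^ q) a = a" for a
  proof (cases "a \<in> S")
    case True
    then show ?thesis using q(2) least_power_dvd[OF Py] by blast
  next
    case False
    then show ?thesis using S(5) by (induction q) auto
  qed
  then have "y ^^ q = id" by auto
  then show ?thesis using mv sym_group_ord_eq_prime[of y n q] D q by (simp add: sym_group_carrier)
qed

text \<open>The hypotheses say that \<open>p\<close> and \<open>q\<close> are 2 and 3 in either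
  order, so that one argument serves both. The only \<open>e\<close> to exclude is 2 when
  \<open>q = 3\<close>, and it is a multiple of \<open>p\<close>.\<close>

lemma dvd_of_bounds_2_3:
  fixes e :: nat
  assumes "prime p" "prime q" "p + q = 5" "0 < e" "e \<le> q" "\<not> p dvd e"
  shows "e dvd q"
proof -
  have "p \<ge> 2" "q \<ge> 2" using assms prime_ge_2_nat by auto
  then have "(p = 2 \<and> q = 3) \<or> (p = 3 \<and> q = 2)" using assms by arith
  moreover have "e = 1 \<or> e = 2 \<or> e = 3" using assms calculation by arith
  ultimately show ?thesis using assms by auto
qed

text \<open>On the \<open>p\<close> points of \<open>M\<close> the estimate leaves only period 1 for
  \<open>y\<close>. On the other \<open>q\<close> points its periods are at most \<open>q\<close>
  and not multiples of \<open>p\<close>, hence divide \<open>q\<close>.\<close>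

lemma difference_graph_5_neighbour:
  assumes xy: "(x, y) \<in> parcs (difference_graph (sym_group 5))"
    and pq: "prime p" "prime q" "p + q = 5"
    and ox: "group.ord (sym_group 5) x = p" and mx: "{a. x a \<noteq> a} = M" and M: "card M = p" "M \<subseteq> {1..5}"
  shows "group.ord (sym_group 5) y = q \<and> {a. y a \<noteq> a} = {1..5} - M"
proof -
  have px: "prime (group.ord (sym_group 5) x)" using pq ox by simp
  note D = sym_group_adj_prime_ordD[OF xy px]
  have Py: "permutation y" using D permutes_imp_permutation by blast
  have fin: "finite M" using M finite_subset by blast
  define C where "C = {1..5} - M"
  have cC: "card C = q" using M fin pq by (simp add: C_def card_Diff_subset)
  have inv: "x ` M \<subseteq> M" "y ` M \<subseteq> M"
    using commute_image_moved(1)[OF D(1), of x] commute_image_moved(1)[OF D(2) D(3)] mx by auto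
  have C: "x ` C \<subseteq> C" "y ` C \<subseteq> C"
    using commute_image_moved(2)[OF D(2) D(3)] mx permutes_image[OF D(2)] by (auto simp: C_def)
  have fM: "y a = a" if "a \<in> M" for a
  proof -
    have "x a \<noteq> a" using that mx by auto
    then have "p * least_power y a \<le> p" "least_power y a > 0"
      using adj_prime_ord_period[OF xy px fin inv that] M ox by auto
    then have "least_power y a = 1" using pq prime_gt_0_nat[of p] by simp
    then show ?thesis using least_power_eq_1[OF Py] by blast
  qed
  have "group.ord (sym_group 5) y = q \<and> {a. y a \<noteq> a} = C"
  proof (rule ord_and_moved_of_neighbour[OF xy px, where m = 1])
    show "y a = a" if "a \<notin> C" for a
      using that fM permutes_not_in[OF D(2)] by (auto simp: C_def)
    show "least_power y s dvd q" if "s \<in> C" for s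
      using adj_prime_ord_period[OF xy px _ C that] dvd_of_bounds_2_3[OF pq] cC ox by (simp add: C_def)
    show "1 * least_power y s \<le> card T" if "T \<subseteq> C" "x ` T \<subseteq> T" "y ` T \<subseteq> T" "s \<in> T" for T s
      using adj_prime_ord_period(2)[OF xy px finite_subset[OF that(1)] that(2-4)] by (simp add: C_def)
    show "C \<noteq> {}" using cC pq by auto
  qed (use C pq cC in \<open>auto simp: C_def\<close>)
  then show ?thesis by (simp add: C_def)
qed

text \<open>On the six points of \<open>M\<close> the estimate reads
  \<open>p * least_power y s \<le> p * q\<close>, so periods are at most \<open>q\<close>. At most
  one point lies outside \<open>M\<close>, and \<open>y\<close> must fix it.\<close>

lemma difference_graph_6_7_neighbour:
  assumes xy: "(x, y) \<in> parcs (difference_graph (sym_group n))" and n: "n \<le> 7"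
    and pq: "prime p" "prime q" "p + q = 5"
    and ox: "group.ord (sym_group n) x = p" and mx: "{a. x a \<noteq> a} = M" and M: "card M = 6"
  shows "group.ord (sym_group n) y = q \<and> {a. y a \<noteq> a} = M"
proof -
  have px: "prime (group.ord (sym_group n) x)" using pq ox by simp
  note D = sym_group_adj_prime_ordD[OF xy px]
  have Py: "permutation y" using D permutes_imp_permutation by blast
  have fin: "finite M" using M by (metis card.infinite zero_neq_numeral)
  have "p \<ge> 2" "q \<ge> 2" using pq prime_ge_2_nat by auto
  then have "(p = 2 \<and> q = 3) \<or> (p = 3 \<and> q = 2)" using pq(3) by arith
  then have pq6: "p * q = 6" by auto
  have inv: "x ` M \<subseteq> M" "y ` M \<subseteq> M"
    using commute_image_moved(1)[OF D(1), of x] commute_image_moved(1)[OF D(2) D(3)] mx by auto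
  have Mn: "M \<subseteq> {1..n}" using mx permutes_not_in[OF D(1)] by blast
  show ?thesis
  proof (rule ord_and_moved_of_neighbour[OF xy px, where m = p])
    show "y a = a" if "a \<notin> M" for a
    proof (cases "a \<in> {1..n}")
      case True
      have "card ({1..n} - M) \<le> 1" using M Mn n fin by (simp add: card_Diff_subset)
      moreover have "a \<in> {1..n} - M" "y a \<in> {1..n} - M"
        using True that commute_image_moved(2)[OF D(2) D(3)] mx permutes_in_image[OF D(2)] by auto
      ultimately show ?thesis using card_le_Suc0_iff_eq[of "{1..n} - M"] by auto
    qed (use permutes_not_in[OF D(2)] in auto)
    show bd: "p * least_power y s \<le> card T" if "T \<subseteq> M" "x ` T \<subseteq> T" "y ` T \<subseteq> T" "s \<in> T" for T s
      using adj_prime_ord_period(1)[OF xy px finite_subset[OF that(1) fin] that(2-4)] that(1,4) mx ox by auto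
    show "least_power y s dvd q" if "s \<in> M" for s
    proof -
      have "p * least_power y s \<le> p * q" using bd[OF _ inv that] M pq6 by simp
      then have "least_power y s \<le> q" using pq prime_gt_0_nat by simp
      then show ?thesis
        using adj_prime_ord_period(3,4)[OF xy px fin inv that] dvd_of_bounds_2_3[OF pq] ox by simp
    qed
    show "M \<noteq> {}" using M by auto
  qed (use inv pq pq6 M fin in auto)
qed

text \<open>A cycle of length 3 leaves at most one further point, which is then fixed. Without one,
  all cycle lengths are 1, 2 or 4.\<close>

lemma funpow_eq_id_le_4:
  fixes n :: nat
  assumes c: "c permutes {1..n}" and n: "n \<le> 4"
  shows "c ^^ 3 = id \<or> c ^^ 4 = id"
proof -
  have P: "permutation c" using permutes_imp_permutation[OF finite_atLeastAtMost c] .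
  have le: "least_power c a \<le> 4" "least_power c a > 0" if "a \<in> {1..n}" for a
    using least_power_le_card[OF P finite_atLeastAtMost _ that] permutes_image[OF c] n
      least_power_of_permutation(2)[OF P] by simp_all
  have out: "(c ^^ k) a = a" if "c a = a" for a k
    by (induction k) (use that in auto)
  show ?thesis
  proof (cases "\<exists>a\<in>{1..n}. least_power c a = 3")
    case True
    then obtain a where a: "a \<in> {1..n}" "least_power c a = 3" by blast
    define Q where "Q = set (support c a)"
    have On: "Q \<subseteq> {1..n}" "finite Q" "card Q = 3"
      using funpow_in_invariant[of c "{1..n}" a] permutes_image[OF c] a distinct_card[OF cycle_of_permutation[OF P, of a]]
      by (auto simp: Q_def)
    have "(c ^^ 3) b = b" for b
    proof (cases "b \<in> Q")
      case True
      then obtain i where "b = (c ^^ i) a" by (auto simp: Q_def)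
      moreover have "(c ^^ 3) a = a" using least_power_of_permutation(1)[OF P, of a] a by simp
      ultimately show ?thesis by (metis funpow_add comp_apply add.commute)
    next
      case False
      show ?thesis
      proof (cases "b \<in> {1..n}")
        case True
        have "c ` Q \<subseteq> Q"
          unfolding Q_def support_set[OF P] by (auto intro: range_eqI[where x = "Suc _"])
        then have "c ` Q = Q" using On permutes_inj[OF c] by (metis endo_inj_surj inj_on_subset subset_UNIV)
        then have "c b \<notin> Q" using False permutes_inj[OF c] by (metis inj_image_mem_iff)
        moreover have "c b \<in> {1..n}" using True permutes_in_image[OF c] by blast
        moreover have "card ({1..n} - Q) \<le> 1" using On n by (simp add: card_Diff_subset)
        ultimately have "c b = b" using True False
          by (metis DiffI One_nat_def card_le_Suc0_iff_eq finite_Diff finite_atLeastAtMost)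
        then show ?thesis using out by blast
      qed (use permutes_not_in[OF c] out in auto)
    qed
    then show ?thesis by auto
  next
    case False
    have "(c ^^ 4) b = b" for b
    proof (cases "b \<in> {1..n}")
      case True
      then have "least_power c b \<le> 4" "least_power c b > 0" "least_power c b \<noteq> 3"
        using le False by auto
      then have "least_power c b = 1 \<or> least_power c b = 2 \<or> least_power c b = 4" by arith
      then have "least_power c b dvd 4" by auto
      then show ?thesis using least_power_dvd[OF P] by blast
    qed (use permutes_not_in[OF c] out in auto)
    then show ?thesis by auto
  qed
qed

text \<open>Adjacent elements are powers of one \<open>c\<close>, whose order divides 3 or 4. Their
  orders are then powers of the same prime, so one divides the other.\<close>

lemma difference_graph_le_4:
  assumes n: "n \<le> 4"
  shows "(x, y) \<notin> parcs (difference_graph (sym_group n))"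
proof
  assume "(x, y) \<in> parcs (difference_graph (sym_group n))"
  then obtain c where c: "c \<in> carrier (sym_group n)" "x \<in> generate (sym_group n) {c}" "y \<in> generate (sym_group n) {c}"
    and d: "\<not> group.ord (sym_group n) x dvd group.ord (sym_group n) y"
      "\<not> group.ord (sym_group n) y dvd group.ord (sym_group n) x"
    unfolding group.difference_graph_adj_iff_ord[OF sym_group_is_group sym_group_finite] by blast
  have dv: "group.ord (sym_group n) u dvd group.ord (sym_group n) c" if "u \<in> generate (sym_group n) {c}" for u
    using group.mem_generate_iff_ord_dvd[OF sym_group_is_group sym_group_finite c(1) that] that
    by (simp add: generate.incl)
  have "group.ord (sym_group n) c dvd 3 ^ 1 \<or> group.ord (sym_group n) c dvd 2 ^ 2"
    using funpow_eq_id_le_4[of c n] n c sym_group_funpow_eq_id[OF c(1)] by (auto simp: sym_group_carrier)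
  then obtain p k :: nat where "prime p" "group.ord (sym_group n) c dvd p ^ k"
  proof
    assume "group.ord (sym_group n) c dvd 3 ^ 1"
    then show thesis by (rule that[rotated]) simp
  next
    assume "group.ord (sym_group n) c dvd 2 ^ 2"
    then show thesis by (rule that[rotated]) simp
  qed
  then obtain i j where "group.ord (sym_group n) x = p ^ i" "group.ord (sym_group n) y = p ^ j"
    using dv c divides_primepow_nat by (metis dvd_trans)
  then show False using d le_imp_power_dvd by (metis linear)
qed

section \<open>Edges built from commuting permutations\<close>

lemma sym_group_adj:
  assumes "x permutes {1..n}" "y permutes {1..n}" "x \<circ> y = y \<circ> x"
    and "prime (group.ord (sym_group n) x)" "prime (group.ord (sym_group n) y)"
    and "group.ord (sym_group n) x \<noteq> group.ord (sym_group n) y"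
  shows "(x, y) \<in> parcs (difference_graph (sym_group n))"
  using assms
  by (intro group.difference_graph_adj_prime_ord[OF sym_group_is_group sym_group_finite])
    (auto simp: sym_group_carrier sym_group_mult)

lemma sym_group_commuting_shift:
  fixes z :: "nat \<Rightarrow> nat" and s :: "nat \<Rightarrow> nat"
  assumes z: "z permutes {1..n}" and d: "0 < d" and r: "prime r"
    and sX: "\<And>i. i < r \<Longrightarrow> s i \<in> {1..n}" and fixd: "\<And>i. i < r \<Longrightarrow> (z ^^ d) (s i) = s i"
    and inj: "inj_on (\<lambda>(k, i). (z ^^ k) (s i)) ({..<d} \<times> {..<r})"
  obtains w where "w permutes {1..n}" "z \<circ> w = w \<circ> z" "group.ord (sym_group n) w = r"
    "{a. w a \<noteq> a} = (\<lambda>(k, i). (z ^^ k) (s i)) ` ({..<d} \<times> {..<r})" "card {a. w a \<noteq> a} = d * r"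
proof -
  have r2: "2 \<le> r" using r prime_ge_2_nat by blast
  obtain w where w: "w permutes {1..n}" "z \<circ> w = w \<circ> z" "w ^^ r = id"
    and mv: "{a. w a \<noteq> a} = (\<lambda>(k, i). (z ^^ k) (s i)) ` ({..<d} \<times> {..<r})"
    using commuting_cyclic_shift[OF z d r2 sX fixd inj] by blast
  have c: "card {a. w a \<noteq> a} = d * r"
    unfolding mv using card_image[OF inj] by simp
  have "w \<noteq> id"
  proof
    assume "w = id"
    then show False using c d r2 by simp
  qed
  then have "group.ord (sym_group n) w = r"
    using w r by (intro sym_group_ord_eq_prime) (auto simp: sym_group_carrier)
  then show ?thesis using that w mv c by blast
qed

text \<open>This is the shift with \<open>d = 1\<close>: every listed point is a
  \<open>z\<close>-cycle by itself, and \<open>w\<close> is the cycle along the list.\<close>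

lemma sym_group_commuting_cycle:
  assumes z: "z permutes {1..n}" and as: "distinct as" "set as \<subseteq> {1..n}" "length as = r" "prime r"
    and fixed: "\<And>a. a \<in> set as \<Longrightarrow> z a = a"
  obtains w where "w permutes {1..n}" "z \<circ> w = w \<circ> z" "group.ord (sym_group n) w = r"
    "{a. w a \<noteq> a} = set as"
proof -
  have inj: "inj_on (\<lambda>(k, i). (z ^^ k) (as ! i)) ({..<1} \<times> {..<r})"
    using as by (auto simp: inj_on_def nth_eq_iff_index_eq)
  have img: "(\<lambda>(k, i). (z ^^ k) (as ! i)) ` ({..<1} \<times> {..<r}) = set as"
  proof -
    have "(\<lambda>(k, i). (z ^^ k) (as ! i)) ` ({..<1} \<times> {..<r}) = (\<lambda>i. as ! i) ` {..<r}"
      by (force simp: lessThan_Suc)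
    then show ?thesis using as by (auto simp: set_conv_nth)
  qed
  show ?thesis
  proof (rule sym_group_commuting_shift[OF z _ \<open>prime r\<close> _ _ inj])
    show "as ! i \<in> {1..n}" "(z ^^ 1) (as ! i) = as ! i" if "i < r" for i
      using that as fixed[of "as ! i"] nth_mem[of i as] by (simp_all add: subset_iff)
  qed (use that img in auto)
qed

lemma transposition_adj_3_cycle:
  assumes "distinct [a, b, c, d, e]" "{a, b, c, d, e} \<subseteq> {1..n}"
  obtains x y where "(x, y) \<in> parcs (difference_graph (sym_group n))"
    "group.ord (sym_group n) x = 2" "{i. x i \<noteq> i} = {a, b}"
    "group.ord (sym_group n) y = 3" "{i. y i \<noteq> i} = {c, d, e}"
proof -
  \<comment> \<open>The identity fixes all points, so the construction commuting with it produces a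
    cycle on any prescribed points.\<close>
  obtain x where x: "x permutes {1..n}" "group.ord (sym_group n) x = 2" "{i. x i \<noteq> i} = {a, b}"
    by (rule sym_group_commuting_cycle[OF permutes_id, of "[a, b]" n 2]) (use assms in \<open>auto intro: that\<close>)
  have fixd: "x i = i" if "i \<in> {c, d, e}" for i
  proof -
    have "i \<notin> {i. x i \<noteq> i}" unfolding x(3) using that assms by auto
    then show ?thesis by simp
  qed
  obtain y where y: "y permutes {1..n}" "x \<circ> y = y \<circ> x" "group.ord (sym_group n) y = 3" "{i. y i \<noteq> i} = {c, d, e}"
    by (rule sym_group_commuting_cycle[OF x(1), of "[c, d, e]" 3]) (use assms fixd in \<open>auto intro: that\<close>)
  have "(x, y) \<in> parcs (difference_graph (sym_group n))"
    using sym_group_adj[OF x(1) y(1,2)] x(2) y(3) by simp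
  then show ?thesis using that x y by blast
qed

section \<open>The three disconnected ranges\<close>

lemma not_connected_le_4:
  assumes "n \<le> 4"
  shows "\<not> Digraph_Component.connected (with_proj (difference_graph (sym_group n)))"
  using difference_graph_le_4[OF assms]
  by (auto simp: connected_conv group.difference_graph_verts[OF sym_group_is_group])

lemma not_connected_5: "\<not> Digraph_Component.connected (with_proj (difference_graph (sym_group 5)))"
proof
  assume con: "Digraph_Component.connected (with_proj (difference_graph (sym_group 5)))"
  let ?P = "\<lambda>x p M. group.ord (sym_group 5) x = p \<and> {i. x i \<noteq> i} = M"
  \<comment> \<open>Closed because each of the two supports is the complement of the other in the
    five symbols.\<close>
  define A where "A = {x. ?P x 2 {1, 2} \<or> ?P x 3 {3, 4, 5}}"
  have compl: "{1..5} - {1, 2::nat} = {3, 4, 5}" "{1..5} - {3, 4, 5::nat} = {1, 2}" by auto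
  have closed: "y \<in> A" if "x \<in> A" and xy: "(x, y) \<in> parcs (difference_graph (sym_group 5))" for x y
  proof -
    from that(1) consider "?P x 2 {1, 2}" | "?P x 3 {3, 4, 5}" by (auto simp: A_def)
    then show ?thesis
    proof cases
      case 1
      then have "?P y 3 ({1..5} - {1, 2})"
        by (intro difference_graph_5_neighbour[OF xy, of 2 3]) auto
      then show ?thesis unfolding compl A_def by blast
    next
      case 2
      then have "?P y 2 ({1..5} - {3, 4, 5})"
        by (intro difference_graph_5_neighbour[OF xy, of 3 2]) auto
      then show ?thesis unfolding compl A_def by blast
    qed
  qed
  obtain u u' where u: "(u, u') \<in> parcs (difference_graph (sym_group 5))" "?P u 2 {1, 2}"
    by (rule transposition_adj_3_cycle[of 1 2 3 4 5 5]) (auto intro: that)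
  \<comment> \<open>The transposition of 1 and 3 is a vertex outside \<open>A\<close>.\<close>
  obtain v v' where v: "(v, v') \<in> parcs (difference_graph (sym_group 5))" "?P v 2 {1, 3}"
    by (rule transposition_adj_3_cycle[of 1 3 2 4 5 5]) (auto intro: that)
  have "v \<in> A" using connected_difference_graph_closed[OF con closed _ u(1) v(1)] u(2) by (auto simp: A_def)
  moreover have "{1, 3} \<noteq> {1, 2::nat}" by (auto simp: doubleton_eq_iff)
  ultimately show False using v(2) by (auto simp: A_def)
qed

lemma not_connected_6_7:
  assumes n: "6 \<le> n" "n \<le> 7"
  shows "\<not> Digraph_Component.connected (with_proj (difference_graph (sym_group n)))"
proof
  assume con: "Digraph_Component.connected (with_proj (difference_graph (sym_group n)))"
  define A where "A = {x. group.ord (sym_group n) x \<in> {2, 3} \<and> card {i. x i \<noteq> i} = 6}"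
  have closed: "y \<in> A" if "x \<in> A" and xy: "(x, y) \<in> parcs (difference_graph (sym_group n))" for x y
    using that(1) difference_graph_6_7_neighbour[OF xy n(2), of 2 3 "{i. x i \<noteq> i}"]
      difference_graph_6_7_neighbour[OF xy n(2), of 3 2 "{i. x i \<noteq> i}"]
    unfolding A_def by auto
  \<comment> \<open>The product of the three transpositions of \<open>i\<close> and
    \<open>i + 3\<close>, a member of \<open>A\<close>. The points 1, 2, 3 represent its 2-cycles,
    and rotating these gives the neighbour \<open>u'\<close> that makes it a vertex.\<close>
  define u :: "nat \<Rightarrow> nat" where "u i = (if i \<in> {1, 2, 3} then i + 3 else if i \<in> {4, 5, 6} then i - 3 else i)" for i
  have uu: "u (u i) = i" for i by (auto simp: u_def)
  then have "bij u" by (metis involuntory_imp_bij)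
  moreover have uout: "u i = i" if "i \<notin> {1..6}" for i using that by (auto simp: u_def)
  ultimately have up: "u permutes {1..n}" using n unfolding permutes_def bij_iff by auto
  have "{i. u i \<noteq> i} = {1, 2, 3, 4, 5, 6}" by (auto simp: u_def)
  then have uc: "card {i. u i \<noteq> i} = 6" by simp
  then have "u \<noteq> id" by auto
  moreover have "u ^^ 2 = id" using uu by (auto simp: numeral_2_eq_2)
  ultimately have uo: "group.ord (sym_group n) u = 2"
    using up by (intro sym_group_ord_eq_prime) (auto simp: sym_group_carrier)
  have inj: "inj_on (\<lambda>(k, i). (u ^^ k) (Suc i)) ({..<2} \<times> {..<3})"
    by (auto simp: inj_on_def less_2_cases_iff u_def numeral_3_eq_3 less_Suc_eq)
  have u2: "(u ^^ 2) i = i" for i using uu by (simp add: numeral_2_eq_2)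
  obtain u' where "u' permutes {1..n}" "u \<circ> u' = u' \<circ> u" "group.ord (sym_group n) u' = 3"
    by (rule sym_group_commuting_shift[OF up _ _ _ _ inj]) (use n u2 in \<open>auto intro: that\<close>)
  then have u: "(u, u') \<in> parcs (difference_graph (sym_group n))"
    using sym_group_adj up uo by auto
  obtain v v' where v: "(v, v') \<in> parcs (difference_graph (sym_group n))" "{i. v i \<noteq> i} = {1, 2}"
    by (rule transposition_adj_3_cycle[of 1 2 3 4 5 n]) (use n in \<open>auto intro: that\<close>)
  have "v \<in> A" using connected_difference_graph_closed[OF con closed _ u v(1)] uo uc by (auto simp: A_def)
  then show False using v(2) by (simp add: A_def)
qed

subsection \<open>Connectedness for at least eight symbols\<close>

lemma ex_mem_notin:
  assumes "finite B" "card B < card A"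
  obtains a where "a \<in> A" "a \<notin> B"
  using assms card_mono[of B A] by (meson not_le subsetI)

lemma disjoint_moved_commute:
  assumes f: "f permutes X" and g: "g permutes X" and disj: "{a. f a \<noteq> a} \<inter> {a. g a \<noteq> a} = {}"
  shows "f \<circ> g = g \<circ> f"
proof
  fix a
  show "(f \<circ> g) a = (g \<circ> f) a"
  proof (cases "f a = a")
    case True
    then have "f (g a) = g a"
      using disj permutes_inj[OF g] by (cases "g a = a") (auto dest: injD)
    then show ?thesis using True by simp
  next
    case False
    then have "f (f a) \<noteq> f a" using permutes_inj[OF f] by (auto dest: injD)
    then have "g (f a) = f a" "g a = a" using disj False by auto
    then show ?thesis by simp
  qed
qed

lemma card_fixed_points:
  assumes "z permutes {1..n}"
  shows "finite {a. z a \<noteq> a}" "{a. z a \<noteq> a} \<subseteq> {1..n}"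
    "card {a \<in> {1..n}. z a = a} = n - card {a. z a \<noteq> a}"
proof -
  show sub: "{a. z a \<noteq> a} \<subseteq> {1..n}" using permutes_not_in[OF assms] by blast
  then show fin: "finite {a. z a \<noteq> a}" using finite_subset by blast
  have "{a \<in> {1..n}. z a = a} = {1..n} - {a. z a \<noteq> a}" by auto
  then show "card {a \<in> {1..n}. z a = a} = n - card {a. z a \<noteq> a}"
    using card_Diff_subset[OF fin sub] by simp
qed

section \<open>Paths from elements of prime order to transpositions\<close>

definition transpositions :: "nat \<Rightarrow> (nat \<Rightarrow> nat) set" where
  "transpositions n = {t. t permutes {1..n} \<and> group.ord (sym_group n) t = 2 \<and> card {a. t a \<noteq> a} = 2}"

definition reaches_transposition :: "nat \<Rightarrow> (nat \<Rightarrow> nat) \<Rightarrow> bool" where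
  "reaches_transposition n z \<longleftrightarrow> (\<exists>t\<in>transpositions n. (z, t) \<in> (parcs (difference_graph (sym_group n)))\<^sup>*)"

lemma reaches_transposition_adj:
  assumes "(x, y) \<in> parcs (difference_graph (sym_group n))" "reaches_transposition n y"
  shows "reaches_transposition n x"
  using assms unfolding reaches_transposition_def by (blast intro: converse_rtrancl_into_rtrancl)

lemma reaches_transposition_odd_with_fixed_points:
  assumes z: "z permutes {1..n}" and p: "prime (group.ord (sym_group n) z)" "group.ord (sym_group n) z \<noteq> 2"
    and fixd: "card {a. z a \<noteq> a} + 2 \<le> n"
  shows "reaches_transposition n z"
proof -
  have "2 \<le> card {a \<in> {1..n}. z a = a}" using card_fixed_points(3)[OF z] fixd by simp
  then obtain B where B: "B \<subseteq> {a \<in> {1..n}. z a = a}" "card B = 2"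
    by (rule obtain_subset_with_card_n)
  then obtain a b where ab: "B = {a, b}" "a \<noteq> b" by (meson card_2_iff)
  obtain t where t: "t permutes {1..n}" "z \<circ> t = t \<circ> z" "group.ord (sym_group n) t = 2" "{i. t i \<noteq> i} = {a, b}"
    by (rule sym_group_commuting_cycle[OF z, of "[a, b]" 2]) (use B ab in \<open>auto intro: that\<close>)
  have "(z, t) \<in> parcs (difference_graph (sym_group n))"
    using sym_group_adj[OF z t(1,2) p(1)] p t by simp
  moreover have "t \<in> transpositions n" using t ab by (simp add: transpositions_def)
  ultimately show ?thesis by (auto simp: reaches_transposition_def)
qed

lemma reaches_transposition_involution:
  assumes n: "8 \<le> n" and z: "z permutes {1..n}" and o: "group.ord (sym_group n) z = 2"
  shows "reaches_transposition n z"
proof -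
  define M where "M = {a. z a \<noteq> a}"
  have fM: "finite M" and Mn: "M \<subseteq> {1..n}" using card_fixed_points[OF z] by (simp_all add: M_def)
  have p3: "prime (3::nat)" by simp
  have "z ^^ 2 = id" using sym_group_funpow_eq_id[of z n 2] z o by (simp add: sym_group_carrier)
  then have zz: "z (z a) = a" for a by (simp add: numeral_2_eq_2 fun_eq_iff)
  have zadj: "(z, w) \<in> parcs (difference_graph (sym_group n))"
    if "w permutes {1..n}" "z \<circ> w = w \<circ> z" "group.ord (sym_group n) w = 3" for w
    using sym_group_adj[OF z that(1,2)] o that by simp
  \<comment> \<open>Moving at most six of at least eight points leaves \<open>w\<close> two fixed
    points to swap.\<close>
  have lnk: "reaches_transposition n z"
    if "w permutes {1..n}" "z \<circ> w = w \<circ> z" "group.ord (sym_group n) w = 3" "card {a. w a \<noteq> a} \<le> 6" for w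
    using reaches_transposition_adj[OF zadj[OF that(1-3)] reaches_transposition_odd_with_fixed_points[OF that(1)]] that n by simp
  show ?thesis
  proof (cases "card M + 3 \<le> n")
    case True
    then have "3 \<le> card {a \<in> {1..n}. z a = a}" using card_fixed_points(3)[OF z] by (simp add: M_def)
    then obtain B where B: "B \<subseteq> {a \<in> {1..n}. z a = a}" "card B = 3"
      by (rule obtain_subset_with_card_n)
    then obtain a b c where abc: "B = {a, b, c}" "a \<noteq> b" "a \<noteq> c" "b \<noteq> c" by (metis card_3_iff)
    obtain w where w: "w permutes {1..n}" "z \<circ> w = w \<circ> z" "group.ord (sym_group n) w = 3" "{i. w i \<noteq> i} = {a, b, c}"
      by (rule sym_group_commuting_cycle[OF z, of "[a, b, c]" 3]) (use B abc in \<open>auto intro: that\<close>)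
    have "card {i. w i \<noteq> i} \<le> 6" using w(4) abc by simp
    then show ?thesis using lnk w by blast
  next
    case False
    \<comment> \<open>At most two fixed points remain, so \<open>z\<close> has at least three
      2-cycles; \<open>a\<close>, \<open>b\<close>, \<open>c\<close> are chosen one from
      each.\<close>
    then have c6: "6 \<le> card M" using n by simp
    obtain a where a: "a \<in> M" using c6 by fastforce
    have "card {a, z a} \<le> 2" by (simp add: card_insert_if)
    then have "card {a, z a} < card M" using c6 by linarith
    then obtain b where b: "b \<in> M" "b \<notin> {a, z a}"
      by (rule ex_mem_notin[rotated]) simp_all
    have "card {a, z a, b, z b} \<le> 4" by (simp add: card_insert_if)
    then have "card {a, z a, b, z b} < card M" using c6 by linarith
    then obtain c where c: "c \<in> M" "c \<notin> {a, z a, b, z b}"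
      by (rule ex_mem_notin[rotated]) simp_all
    have ne: "z a \<noteq> a" "z b \<noteq> b" "z c \<noteq> c" "a \<noteq> b" "z a \<noteq> b" "a \<noteq> z b" "z a \<noteq> z b"
      "a \<noteq> c" "z a \<noteq> c" "a \<noteq> z c" "z a \<noteq> z c" "b \<noteq> c" "z b \<noteq> c" "b \<noteq> z c" "z b \<noteq> z c"
      using a b c zz by (auto simp: M_def) (metis zz)+
    have inj: "inj_on (\<lambda>(k, i). (z ^^ k) ([a, b, c] ! i)) ({..<2} \<times> {..<3})"
      by (auto simp: inj_on_def less_2_cases_iff numeral_3_eq_3 less_Suc_eq ne ne[symmetric])
    obtain w where w: "w permutes {1..n}" "z \<circ> w = w \<circ> z" "group.ord (sym_group n) w = 3"
        "card {a. w a \<noteq> a} = 2 * 3"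
    proof (rule sym_group_commuting_shift[OF z _ p3 _ _ inj])
      show "[a, b, c] ! i \<in> {1..n}" "(z ^^ 2) ([a, b, c] ! i) = [a, b, c] ! i" if "i < 3" for i
        using a b c Mn that zz by (auto simp: numeral_3_eq_3 less_Suc_eq numeral_2_eq_2)
    qed (use that in auto)
    then show ?thesis using lnk by simp
  qed
qed

text \<open>Every nontrivial cycle of \<open>z\<close> has length \<open>p\<close>, so the two
  cycles through \<open>s\<close> and \<open>t\<close> can be swapped by an involution commuting
  with \<open>z\<close>, and involutions are already settled.\<close>

lemma reaches_transposition_two_cycles:
  assumes n: "8 \<le> n" and z: "z permutes {1..n}" and p: "prime p" "group.ord (sym_group n) z = p" "p \<noteq> 2"
    and st: "z s \<noteq> s" "z t \<noteq> t" "t \<notin> set (support z s)"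
  shows "reaches_transposition n z"
proof -
  have P: "permutation z" using z permutes_imp_permutation by blast
  have zp: "z ^^ p = id" using sym_group_funpow_eq_id[of z n p] z p by (simp add: sym_group_carrier)
  have lp: "least_power z a = p" if "z a \<noteq> a" for a
  proof -
    have "least_power z a dvd p" using zp least_power_dvd[OF P] by simp
    then show ?thesis using p(1) least_power_gt_one[OF P that] by (auto simp: prime_nat_iff)
  qed
  have disj: "set (support z t) \<inter> set (support z s) = {}"
    using disjoint_support'[OF P] st(3) by blast
  have eq: "k = l" if "(z ^^ k) a = (z ^^ l) a" "k < p" "l < p" "z a \<noteq> a" for k l a
    using cycle_of_permutation[OF P, of a] that lp[of a] by (auto simp: distinct_map inj_on_def)
  have ne: "(z ^^ k) s \<noteq> (z ^^ l) t" if "k < p" "l < p" for k l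
    using disj lp st that by fastforce
  \<comment> \<open>Points with the same index differ because a cycle lists \<open>p\<close>
    distinct points; points with different indices lie in disjoint cycles.\<close>
  have inj: "inj_on (\<lambda>(k, i). (z ^^ k) ([s, t] ! i)) ({..<p} \<times> {..<2})"
  proof (rule inj_onI)
    fix u v :: "nat \<times> nat"
    assume u: "u \<in> {..<p} \<times> {..<2}" and v: "v \<in> {..<p} \<times> {..<2}"
      and e: "(\<lambda>(k, i). (z ^^ k) ([s, t] ! i)) u = (\<lambda>(k, i). (z ^^ k) ([s, t] ! i)) v"
    obtain k i l j where kl: "u = (k, i)" "v = (l, j)" by (cases u, cases v) auto
    have b: "k < p" "l < p" "i = 0 \<or> i = 1" "j = 0 \<or> j = 1" using u v kl by auto
    have "(z ^^ k) ([s, t] ! i) = (z ^^ l) ([s, t] ! j)" using e kl by simp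
    then show "u = v"
      unfolding kl using b(3,4) eq[OF _ b(1,2), of s] eq[OF _ b(1,2), of t] st(1,2)
        ne[OF b(1,2)] ne[OF b(2,1), symmetric] by (elim disjE) simp_all
  qed
  obtain w where w: "w permutes {1..n}" "z \<circ> w = w \<circ> z" "group.ord (sym_group n) w = 2"
  proof (rule sym_group_commuting_shift[OF z _ two_is_prime_nat _ _ inj])
    show "0 < p" using p prime_gt_0_nat by blast
    show "[s, t] ! i \<in> {1..n}" if "i < 2" for i
      using st that permutes_not_in[OF z] by (auto simp: less_2_cases_iff)
    show "(z ^^ p) ([s, t] ! i) = [s, t] ! i" for i using zp by simp
  qed (use that in auto)
  have "(z, w) \<in> parcs (difference_graph (sym_group n))"
    using sym_group_adj[OF z w(1,2)] p w by simp
  then show ?thesis using reaches_transposition_adj reaches_transposition_involution[OF n w(1,3)] by blast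
qed

lemma reaches_transposition_prime_ord:
  assumes n: "8 \<le> n" and zw: "(z, w) \<in> parcs (difference_graph (sym_group n))"
    and pz: "prime (group.ord (sym_group n) z)"
  shows "reaches_transposition n z"
proof -
  note D = sym_group_adj_prime_ordD[OF zw pz]
  define p where "p = group.ord (sym_group n) z"
  define M where "M = {a. z a \<noteq> a}"
  have P: "permutation z" "permutation w" using D permutes_imp_permutation by blast+
  have fM: "finite M" and Mn: "M \<subseteq> {1..n}" using card_fixed_points[OF D(1)] by (simp_all add: M_def)
  consider "p = 2" | "card M + 2 \<le> n" "p \<noteq> 2" | s t where "p \<noteq> 2" "s \<in> M" "t \<in> M" "t \<notin> set (support z s)"
    | "n < card M + 2" "\<forall>s\<in>M. M \<subseteq> set (support z s)" by fastforce
  then show ?thesis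
  proof cases
    case 1
    then show ?thesis using reaches_transposition_involution[OF n D(1)] by (simp add: p_def)
  next
    case 2
    then show ?thesis using reaches_transposition_odd_with_fixed_points[OF D(1) pz] by (simp add: p_def M_def)
  next
    case 3
    then show ?thesis using reaches_transposition_two_cycles[OF n D(1) pz refl] by (simp add: p_def M_def)
  next
    case 4
    \<comment> \<open>Here \<open>z\<close> is one cycle missing at most one point. The estimate
      forces the neighbour \<open>w\<close> to fix all of \<open>M\<close>, and any remaining point
      as well, so \<open>w\<close> would be the identity.\<close>
    have inv: "z ` M \<subseteq> M" "w ` M \<subseteq> M"
      using commute_image_moved(1)[OF D(1), of z] commute_image_moved(1)[OF D(2) D(3)] by (auto simp: M_def)
    have cM: "card M \<le> p" if "s \<in> M" for s
    proof -
      have "card M \<le> card (set (support z s))" using 4(2) that by (intro card_mono) auto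
      also have "\<dots> = least_power z s" using distinct_card[OF cycle_of_permutation[OF P(1)]] by simp
      also have "\<dots> \<le> p"
      proof (rule dvd_imp_le)
        have "z ^^ p = id" using sym_group_funpow_eq_id[of z n p] D(1) by (simp add: sym_group_carrier p_def)
        then show "least_power z s dvd p" using least_power_dvd[OF P(1)] by simp
        show "0 < p" using pz prime_gt_0_nat by (simp add: p_def)
      qed
      finally show ?thesis .
    qed
    have "w a = a" for a
    proof (cases "a \<in> M")
      case True
      have "p * least_power w a \<le> card M" "0 < least_power w a"
        using adj_prime_ord_period(1,3)[OF zw pz fM inv True] True by (simp_all add: M_def p_def)
      moreover have "0 < p" using pz prime_gt_0_nat by (simp add: p_def)
      moreover have "p * least_power w a \<le> p * 1" using le_trans[OF calculation(1) cM[OF True]] by (simp only: mult_1_right)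
      ultimately have "least_power w a = 1" by (metis One_nat_def Suc_leI le_antisym mult_le_cancel1)
      then show ?thesis using least_power_eq_1[OF P(2)] by blast
    next
      case False
      show ?thesis
      proof (cases "a \<in> {1..n}")
        case True
        then have "a \<in> {a \<in> {1..n}. z a = a}" "w a \<in> {a \<in> {1..n}. z a = a}"
          using False commute_image_moved(2)[OF D(2) D(3)] permutes_in_image[OF D(2)] by (auto simp: M_def)
        moreover have "card {a \<in> {1..n}. z a = a} \<le> 1"
          using card_fixed_points(3)[OF D(1)] 4(1) by (simp add: M_def)
        ultimately show ?thesis using card_le_Suc0_iff_eq[of "{a \<in> {1..n}. z a = a}"] by auto
      qed (use permutes_not_in[OF D(2)] in auto)
    qed
    then show ?thesis using D(5) by auto
  qed
qed

text \<open>Together the two supports have at most four points, which leaves room for a 3-cycle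
  adjacent to both.\<close>

lemma transpositions_reach:
  assumes n: "8 \<le> n" and t: "t \<in> transpositions n" "t' \<in> transpositions n"
  shows "(t, t') \<in> (parcs (difference_graph (sym_group n)))\<^sup>*"
proof -
  have tp: "t permutes {1..n}" "t' permutes {1..n}" and o: "group.ord (sym_group n) t = 2" "group.ord (sym_group n) t' = 2"
    and c: "card {a. t a \<noteq> a} = 2" "card {a. t' a \<noteq> a} = 2"
    using t by (auto simp: transpositions_def)
  let ?M = "{a. t a \<noteq> a} \<union> {a. t' a \<noteq> a}"
  have "card ?M \<le> 4" using card_Un_le[of "{a. t a \<noteq> a}" "{a. t' a \<noteq> a}"] c by simp
  moreover have "?M \<subseteq> {1..n}" "finite ?M" using card_fixed_points tp by auto
  ultimately have "3 \<le> card ({1..n} - ?M)" using n by (simp add: card_Diff_subset)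
  then obtain B where B: "B \<subseteq> {1..n} - ?M" "card B = 3"
    by (rule obtain_subset_with_card_n)
  then obtain u v x where uvx: "B = {u, v, x}" "u \<noteq> v" "u \<noteq> x" "v \<noteq> x" by (metis card_3_iff)
  obtain w where w: "w permutes {1..n}" "t \<circ> w = w \<circ> t" "group.ord (sym_group n) w = 3" "{i. w i \<noteq> i} = {u, v, x}"
    by (rule sym_group_commuting_cycle[OF tp(1), of "[u, v, x]" 3]) (use B uvx in \<open>auto intro: that\<close>)
  have "{i. w i \<noteq> i} \<inter> {a. t' a \<noteq> a} = {}" unfolding w(4) using B uvx by auto
  then have "w \<circ> t' = t' \<circ> w" using disjoint_moved_commute w(1) tp(2) by blast
  then have "(t, w) \<in> parcs (difference_graph (sym_group n))" "(w, t') \<in> parcs (difference_graph (sym_group n))"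
    using sym_group_adj[OF tp(1) w(1,2)] sym_group_adj[OF w(1) tp(2)] o w(3) by simp_all
  then show ?thesis by (meson r_into_rtrancl rtrancl_trans)
qed

lemma connected_ge_8:
  assumes n: "8 \<le> n"
  shows "Digraph_Component.connected (with_proj (difference_graph (sym_group n)))"
proof -
  let ?E = "parcs (difference_graph (sym_group n))"
  obtain h h' where h: "(h, h') \<in> ?E" "group.ord (sym_group n) h = 2" "{i. h i \<noteq> i} = {1, 2}"
    by (rule transposition_adj_3_cycle[of 1 2 3 4 5 n]) (use n in \<open>auto intro: that\<close>)
  have "h permutes {1..n}" using sym_group_adj_prime_ordD(1)[OF h(1)] h(2) by simp
  then have hT: "h \<in> transpositions n" using h by (simp add: transpositions_def)
  show ?thesis
  proof (rule connected_difference_graphI)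
    show "h \<in> pverts (difference_graph (sym_group n))" using difference_graph_arc_verts h(1) by blast
    fix v v' assume "(v, v') \<in> ?E"
    then obtain y z w where y: "(v, y) \<in> ?E" "(y, z) \<in> ?E"
      and z: "z \<in> carrier (sym_group n)" "w \<in> carrier (sym_group n)" "z \<circ> w = w \<circ> z"
      and p: "prime (group.ord (sym_group n) z)" "prime (group.ord (sym_group n) w)"
        "group.ord (sym_group n) z \<noteq> group.ord (sym_group n) w"
      using group.difference_graph_reaches_prime_ord[OF sym_group_is_group sym_group_finite]
      unfolding sym_group_mult by metis
    \<comment> \<open>The commuting partner supplies the neighbour of \<open>z\<close> that excludes
      the single-cycle case.\<close>
    have "(z, w) \<in> ?E" using sym_group_adj z p by (simp add: sym_group_carrier)
    then have "reaches_transposition n v" using reaches_transposition_adj y reaches_transposition_prime_ord[OF n _ p(1)] by blast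
    then show "(v, h) \<in> ?E\<^sup>*"
      using transpositions_reach[OF n _ hT] unfolding reaches_transposition_def by (meson rtrancl_trans)
  qed
qed

theorem theorem4p1:
  fixes n :: nat
  shows "Digraph_Component.connected (with_proj (difference_graph (sym_group n))) \<longleftrightarrow> n \<ge> 8"
proof -
  consider "n \<le> 4" | "n = 5" | "6 \<le> n" "n \<le> 7" | "8 \<le> n" by arith
  then show ?thesis
    by cases (use not_connected_le_4 not_connected_5 not_connected_6_7 connected_ge_8 in auto)
qed

end
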